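(* For all integers $k,l,m$ with $3\le k<l$ and $l+\frac{k-1}{2}<m<k+l-1$, $r(k,l,m)=2k+2l-3$.
   Context: For a graph whose edges are coloured with red, blue and green, a red (resp. blue, green) $t$-connected matching is a connected component of the spanning subgraph formed by the red (resp. blue, green) edges whose maximum matching has size at least $t$. For positive integers $k,l,m$, $r(k,l,m)$ denotes the smallest integer $n$ such that every red-blue-green colouring of the edges of $K_{n,n}$ contains a red $k$-connected matching, or a blue $l$-connected matching, or a green $m$-connected matching. *)

theory Defs
  imports Complex_Main "HOL-Library.Disjoint_Sets"
begin

text \<open>
  A graph is a pair of a vertex set and an edge set, an edge being the set of its end points.
\<close>

type_synonym 'a graph = "'a set \<times> 'a set set"

definition verts :: "'a graph \<Rightarrow> 'a set" where
  "verts G = fst G"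

definition edges :: "'a graph \<Rightarrow> 'a set set" where
  "edges G = snd G"

definition reachable :: "'a graph \<Rightarrow> 'a \<Rightarrow> 'a \<Rightarrow> bool" where
  "reachable G u v \<longleftrightarrow> (u, v) \<in> {(x, y). {x, y} \<in> edges G}\<^sup>*"

definition induced :: "'a graph \<Rightarrow> 'a set \<Rightarrow> 'a graph" where
  "induced G C = (C, {e \<in> edges G. e \<subseteq> C})"

definition components :: "'a graph \<Rightarrow> 'a graph set" where
  "components G = {induced G {v \<in> verts G. reachable G u v} | u. u \<in> verts G}"

definition is_matching :: "'a graph \<Rightarrow> 'a set set \<Rightarrow> bool" where
  "is_matching G M \<longleftrightarrow> M \<subseteq> edges G \<and> disjoint M"

text \<open>The size of a maximum matching; meaningful for graphs with finitely many edges.\<close>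

definition matching_number :: "'a graph \<Rightarrow> nat" where
  "matching_number G = Max {card M | M. is_matching G M}"

definition complete_bipartite :: "nat \<Rightarrow> nat \<Rightarrow> (nat + nat) graph" where
  "complete_bipartite a b = ({..<a} <+> {..<b}, {{Inl i, Inr j} | i j. i < a \<and> j < b})"

datatype colour = Red | Blue | Green

text \<open>
  A colouring is a total function on sets of vertices; its values outside the edge set of the
  graph are irrelevant, since \<open>colour_subgraph\<close> only looks at edges.
\<close>

definition colour_subgraph :: "'a graph \<Rightarrow> ('a set \<Rightarrow> colour) \<Rightarrow> colour \<Rightarrow> 'a graph" where
  "colour_subgraph G f c = (verts G, {e \<in> edges G. f e = c})"

definition has_connected_matching ::
  "'a graph \<Rightarrow> ('a set \<Rightarrow> colour) \<Rightarrow> colour \<Rightarrow> nat \<Rightarrow> bool" where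
  "has_connected_matching G f c t \<longleftrightarrow>
     (\<exists>H \<in> components (colour_subgraph G f c). matching_number H \<ge> t)"

text \<open>
  The infimum of a nonempty set of naturals is its least element, while the infimum of the empty
  set is 0; so a positive value of \<open>r k l m\<close> includes the existence of a suitable \<open>n\<close>.
\<close>

definition r :: "nat \<Rightarrow> nat \<Rightarrow> nat \<Rightarrow> nat" where
  "r k l m = Inf {n. \<forall>f :: (nat + nat) set \<Rightarrow> colour.
     has_connected_matching (complete_bipartite n n) f Red k \<or>
     has_connected_matching (complete_bipartite n n) f Blue l \<or>
     has_connected_matching (complete_bipartite n n) f Green m}"

end

theory Submission
  imports Defs
begin

text \<open>
  Write \<open>k = s + 1\<close>, \<open>l = t + 1\<close> and \<open>c = s + t\<close>. By Koenig's theorem a colouring avoids the three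
  matchings iff every red, blue and green component has a vertex cover of size at most \<open>s\<close>, \<open>t\<close> and
  \<open>m - 1 \<le> c\<close>, respectively. Suppose this holds with both sides of size \<open>2 * c + 1\<close>. Call a
  complete bipartite subgraph without green edges joined. In a joined pair either all vertices lie
  in two red and in two blue components, or the cover of one red and the cover of one blue
  component meet all edges; in the first case the vertices that belong to a cover number at most
  \<open>2 * c\<close>, in the second one of the sides has at most \<open>c\<close> vertices. This excludes a cyclic
  arrangement of six parts of size at most \<open>c\<close> in which neighbouring parts are joined, and an
  arrangement of six parts along a path whose two end parts together have at most \<open>c\<close> vertices.
  One of the two always exists: either some green component has more than \<open>c\<close> vertices on each
  side, and its cover provides the end parts of a path, or the green components can be merged into
  three groups with at most \<open>c\<close> vertices on each side.
\<close>

section \<open>Koenig's theorem for finite bipartite edge sets\<close>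

text \<open>Edges are deleted as long as every cover of the rest has at least \<open>t\<close>
  vertices. Once each edge is critical, no two of them share an end point, so the remaining edges
  form a matching, and their left end points form a cover.\<close>

lemma koenig:
  fixes E :: "('a \<times> 'b) set"
  assumes "finite E"
    and "\<And>P Q. finite P \<Longrightarrow> finite Q \<Longrightarrow> (\<And>x y. (x, y) \<in> E \<Longrightarrow> x \<in> P \<or> y \<in> Q) \<Longrightarrow> t \<le> card P + card Q"
  shows "\<exists>M\<subseteq>E. inj_on fst M \<and> inj_on snd M \<and> t \<le> card M"
  using assms
proof (induction E rule: finite_psubset_induct)
  case (psubset E)
  define cov where "cov F P Q \<longleftrightarrow> finite P \<and> finite Q \<and> (\<forall>x y. (x, y) \<in> F \<longrightarrow> x \<in> P \<or> y \<in> Q)"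
    for F :: "('a \<times> 'b) set" and P Q
  have lower: "t \<le> card P + card Q" if "cov E P Q" for P Q
    using that psubset.prems[of P Q] unfolding cov_def by blast
  show ?case
  proof (cases "\<exists>e\<in>E. \<forall>P Q. cov (E - {e}) P Q \<longrightarrow> t \<le> card P + card Q")
    case True
    then obtain e where e: "e \<in> E" "\<And>P Q. cov (E - {e}) P Q \<Longrightarrow> t \<le> card P + card Q"
      by blast
    have "\<exists>M\<subseteq>E - {e}. inj_on fst M \<and> inj_on snd M \<and> t \<le> card M"
    proof (rule psubset.IH)
      show "E - {e} \<subset> E" using e by blast
    qed (use e in \<open>auto simp: cov_def\<close>)
    then show ?thesis by blast
  next
    case False
    then have crit: "\<exists>P Q. cov (E - {e}) P Q \<and> card P + card Q < t" if "e \<in> E" for e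
      using that by (meson not_le)
    \<comment> \<open>A small cover containing an end point of the deleted edge would cover all of
      \<open>E\<close>.\<close>
    have crit': "\<exists>P Q. cov (E - {(x, y)}) P Q \<and> card P + card Q < t \<and> x \<notin> P \<and> y \<notin> Q"
      if xy: "(x, y) \<in> E" for x y
    proof -
      obtain P Q where PQ: "cov (E - {(x, y)}) P Q" "card P + card Q < t" using crit[OF xy] by blast
      have "\<not> cov E P Q" using lower[of P Q] PQ(2) by linarith
      then have "x \<notin> P \<and> y \<notin> Q" using PQ(1) unfolding cov_def by blast
      with PQ show ?thesis by blast
    qed
    \<comment> \<open>Submodularity: the union on one side with the intersection on the other, and vice versa,
      is a cover, up to adding the common end point in one of the two.\<close>
    have uncross: False
      if e: "(x, y) \<in> E" and f: "(x', y') \<in> E" and ne: "(x, y) \<noteq> (x', y')"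
        and share: "x = x' \<or> y = y'" for x y x' y'
    proof -
      obtain P Q where PQ: "cov (E - {(x, y)}) P Q" "card P + card Q < t" "x \<notin> P" "y \<notin> Q"
        using crit'[OF e] by blast
      obtain P' Q' where PQ': "cov (E - {(x', y')}) P' Q'" "card P' + card Q' < t" "x' \<notin> P'" "y' \<notin> Q'"
        using crit'[OF f] by blast
      have fin: "finite P" "finite Q" "finite P'" "finite Q'" using PQ PQ' by (auto simp: cov_def)
      have sums: "card (P \<union> P') + card (P \<inter> P') = card P + card P'"
        "card (Q \<union> Q') + card (Q \<inter> Q') = card Q + card Q'"
        using card_Un_Int[OF fin(1,3)] card_Un_Int[OF fin(2,4)] by simp_all
      have e': "x \<in> P' \<or> y \<in> Q'" and f': "x' \<in> P \<or> y' \<in> Q"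
        using PQ(1) PQ'(1) e f ne unfolding cov_def by blast+
      have both: "(u \<in> P \<or> v \<in> Q) \<and> (u \<in> P' \<or> v \<in> Q') \<or> (u, v) = (x, y) \<or> (u, v) = (x', y')"
        if "(u, v) \<in> E" for u v
        using PQ(1) PQ'(1) that unfolding cov_def by blast
      show False
        using share
      proof
        assume s: "x = x'"
        have Q: "y \<in> Q'" "y' \<in> Q" using s e' f' PQ PQ' by auto
        have "u \<in> P \<inter> P' \<or> v \<in> Q \<union> Q'" if "(u, v) \<in> E" for u v
          using both[OF that] Q by blast
        then have 1: "cov E (P \<inter> P') (Q \<union> Q')" using fin unfolding cov_def by blast
        have "u \<in> insert x (P \<union> P') \<or> v \<in> Q \<inter> Q'" if "(u, v) \<in> E" for u v
          using both[OF that] s by blast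
        then have 2: "cov E (insert x (P \<union> P')) (Q \<inter> Q')" using fin unfolding cov_def by blast
        \<comment> \<open>Each given cover has at most \<open>t - 1\<close> vertices, so the two new
          ones have at most \<open>2 * t - 1\<close> together, and one of them is smaller than
          \<open>t\<close>.\<close>
        have "card (insert x (P \<union> P')) \<le> Suc (card (P \<union> P'))"
          using fin by (simp add: card_insert_if)
        then show False using lower[OF 1] lower[OF 2] sums PQ(2) PQ'(2) by linarith
      next
        assume s: "y = y'"
        have P: "x \<in> P'" "x' \<in> P" using s e' f' PQ PQ' by auto
        have "u \<in> P \<union> P' \<or> v \<in> Q \<inter> Q'" if "(u, v) \<in> E" for u v
          using both[OF that] P by blast
        then have 1: "cov E (P \<union> P') (Q \<inter> Q')" using fin unfolding cov_def by blast
        have "u \<in> P \<inter> P' \<or> v \<in> insert y (Q \<union> Q')" if "(u, v) \<in> E" for u v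
          using both[OF that] s by blast
        then have 2: "cov E (P \<inter> P') (insert y (Q \<union> Q'))" using fin unfolding cov_def by blast
        have "card (insert y (Q \<union> Q')) \<le> Suc (card (Q \<union> Q'))"
          using fin by (simp add: card_insert_if)
        then show False using lower[OF 1] lower[OF 2] sums PQ(2) PQ'(2) by linarith
      qed
    qed
    have "cov E (fst ` E) {}" using psubset.hyps by (force simp: cov_def)
    then have "t \<le> card (fst ` E)" using lower by fastforce
    also have "\<dots> \<le> card E" by (rule card_image_le) (rule psubset.hyps)
    finally have "t \<le> card E" .
    moreover have "y = y'" if "(x, y) \<in> E" "(x, y') \<in> E" for x y y'
      using uncross[OF that] by blast
    then have "inj_on fst E" by (auto simp: inj_on_def)
    moreover have "x = x'" if "(x, y) \<in> E" "(x', y) \<in> E" for x x' y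
      using uncross[OF that] by blast
    then have "inj_on snd E" by (auto simp: inj_on_def)
    ultimately show ?thesis by blast
  qed
qed

section \<open>Component labels, covers and joined pairs\<close>

text \<open>With \<open>lab\<close> naming components and \<open>K\<close> the union of their
  covers, this holds for every edge of one colour. The counting arguments see the graph only through
  this condition.\<close>

definition covered :: "('v \<Rightarrow> 'l) \<Rightarrow> 'v set \<Rightarrow> 'v \<Rightarrow> 'v \<Rightarrow> bool" where
  "covered lab K x y \<longleftrightarrow> lab x = lab y \<and> (x \<in> K \<or> y \<in> K)"

text \<open>A vertex of \<open>A\<close> outside \<open>K\<close> forces all of \<open>B\<close>
  into \<open>K\<close>: a vertex cover of a complete bipartite graph contains one side.\<close>

lemma biclique_cover_side:
  assumes "\<And>x y. x \<in> A \<Longrightarrow> y \<in> B \<Longrightarrow> covered lab K x y \<and> lab x = \<mu>" "A \<noteq> {}" "B \<noteq> {}"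
  shows "A \<subseteq> {v \<in> K. lab v = \<mu>} \<or> B \<subseteq> {v \<in> K. lab v = \<mu>}"
proof -
  obtain x0 y0 where 0: "x0 \<in> A" "y0 \<in> B" using assms(2,3) by blast
  have A: "lab x = \<mu>" if "x \<in> A" for x using assms(1)[OF that 0(2)] by simp
  have B: "lab y = \<mu>" if "y \<in> B" for y using assms(1)[OF 0(1) that] by (auto simp: covered_def)
  show ?thesis
  proof (cases "A \<subseteq> K")
    case True
    then show ?thesis using A by blast
  next
    case False
    then obtain x where x: "x \<in> A" "x \<notin> K" by blast
    have "y \<in> K" if "y \<in> B" for y using assms(1)[OF x(1) that] x(2) by (simp add: covered_def)
    then show ?thesis using B by blast
  qed
qed

text \<open>
  The values of \<open>r\<close> and \<open>b\<close> name the red and the blue component of a vertex, and \<open>KR\<close> and \<open>KB\<close> are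
  the unions of the vertex covers of the red and of the blue components.
\<close>

locale two_covers =
  fixes r b :: "'v \<Rightarrow> 'l" and KR KB :: "'v set" and s t :: nat
  assumes fin: "finite KR" "finite KB"
    and red_le: "card {v \<in> KR. r v = \<rho>} \<le> s"
    and blue_le: "card {v \<in> KB. b v = \<beta>} \<le> t"
begin

definition joined :: "'v set \<Rightarrow> 'v set \<Rightarrow> bool" where
  "joined U V \<longleftrightarrow> (\<forall>x\<in>U. \<forall>y\<in>V. covered r KR x y \<or> covered b KB x y)"

definition cov :: "'l \<Rightarrow> 'l \<Rightarrow> 'v set" where
  "cov \<rho> \<beta> = {v \<in> KR. r v = \<rho>} \<union> {v \<in> KB. b v = \<beta>}"

definition grid :: "'v set \<Rightarrow> bool" where
  "grid W \<longleftrightarrow> (\<exists>\<rho> \<rho>' \<beta> \<beta>'. \<forall>v\<in>W. (r v = \<rho> \<or> r v = \<rho>') \<and> (b v = \<beta> \<or> b v = \<beta>'))"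

text \<open>This makes \<open>cov \<rho> \<beta>\<close> a vertex cover of the pair. It also records
  in which component an edge is covered, which \<open>simple_pair\<close> exploits.\<close>

definition simple :: "'l \<Rightarrow> 'l \<Rightarrow> 'v set \<Rightarrow> 'v set \<Rightarrow> bool" where
  "simple \<rho> \<beta> U V \<longleftrightarrow> (\<forall>x\<in>U. \<forall>y\<in>V. covered r KR x y \<and> r x = \<rho> \<or> covered b KB x y \<and> b x = \<beta>)"

lemma joined_sym:
  assumes "joined U V" shows "joined V U"
  unfolding joined_def
proof (intro ballI)
  fix y x assume "y \<in> V" "x \<in> U"
  then have "covered r KR x y \<or> covered b KB x y" using assms unfolding joined_def by blast
  then show "covered r KR y x \<or> covered b KB y x" by (auto simp: covered_def)
qed

lemma finite_cov: "finite (cov \<rho> \<beta>)"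
  using fin by (simp add: cov_def)

lemma card_cov: "card (cov \<rho> \<beta>) \<le> s + t"
  using card_Un_le[of "{v \<in> KR. r v = \<rho>}" "{v \<in> KB. b v = \<beta>}"] red_le[of \<rho>] blue_le[of \<beta>]
  by (simp add: cov_def)

lemma card_le_cov:
  assumes "W \<subseteq> cov \<rho> \<beta>" shows "card W \<le> s + t"
  using card_mono[OF finite_cov assms] card_cov[of \<rho> \<beta>] by simp

text \<open>A vertex \<open>x\<close> of \<open>U\<close> outside both covers would force all of
  \<open>V\<close> into \<open>cov (r x) (b x)\<close>, which is too small.\<close>

lemma joined_covers:
  assumes "joined U V" "s + t < card V" shows "U \<subseteq> KR \<union> KB"
proof (rule subsetI, rule ccontr)
  fix x assume x: "x \<in> U" "x \<notin> KR \<union> KB"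
  have "V \<subseteq> cov (r x) (b x)"
  proof
    fix y assume "y \<in> V"
    then have "covered r KR x y \<or> covered b KB x y" using assms(1) x unfolding joined_def by blast
    then show "y \<in> cov (r x) (b x)" using x unfolding covered_def cov_def by auto
  qed
  from card_le_cov[OF this] show False using assms(2) by simp
qed

lemma simple_covers:
  assumes "simple \<rho> \<beta> U V" "s + t < card V" shows "U \<subseteq> cov \<rho> \<beta>"
proof (rule subsetI, rule ccontr)
  fix x assume x: "x \<in> U" "x \<notin> cov \<rho> \<beta>"
  have "V \<subseteq> cov \<rho> \<beta>"
  proof
    fix y assume "y \<in> V"
    then have "covered r KR x y \<and> r x = \<rho> \<or> covered b KB x y \<and> b x = \<beta>"
      using assms(1) x unfolding simple_def by blast
    then show "y \<in> cov \<rho> \<beta>" using x unfolding covered_def cov_def by auto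
  qed
  from card_le_cov[OF this] show False using assms(2) by simp
qed

text \<open>Two red and two blue covers contain \<open>W\<close>; one of each colour makes a set
  \<open>cov\<close>, so two such sets suffice.\<close>

lemma grid_card:
  assumes "grid W" "W \<subseteq> KR \<union> KB" shows "card W \<le> 2 * (s + t)"
proof -
  obtain \<rho> \<rho>' \<beta> \<beta>' where *: "\<forall>v\<in>W. (r v = \<rho> \<or> r v = \<rho>') \<and> (b v = \<beta> \<or> b v = \<beta>')"
    using assms(1) unfolding grid_def by blast
  have "W \<subseteq> cov \<rho> \<beta> \<union> cov \<rho>' \<beta>'" using * assms(2) unfolding cov_def by blast
  then have "card W \<le> card (cov \<rho> \<beta> \<union> cov \<rho>' \<beta>')" by (simp add: card_mono finite_cov)
  also have "\<dots> \<le> card (cov \<rho> \<beta>) + card (cov \<rho>' \<beta>')" by (rule card_Un_le)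
  finally show ?thesis using card_cov[of \<rho> \<beta>] card_cov[of \<rho>' \<beta>'] by simp
qed

text \<open>A vertex of \<open>V\<close> agrees with each of \<open>x\<close> and \<open>x'\<close>
  in some colour, so its labels are \<open>(r x, b x')\<close> or \<open>(r x', b x)\<close>. If
  only one of these types occurs, the pair is simple; if both occur, they confine \<open>U\<close>
  to the same four labels.\<close>

lemma simple_or_grid_disagreeing:
  assumes "joined U V" and x: "x \<in> U" "x' \<in> U" "r x \<noteq> r x'" "b x \<noteq> b x'"
  shows "(\<exists>\<rho> \<beta>. simple \<rho> \<beta> U V) \<or> grid (U \<union> V)"
proof -
  have agree: "r u = r v \<or> b u = b v" if "u \<in> U" "v \<in> V" for u v
    using assms(1) that unfolding joined_def covered_def by blast
  have V: "r y = r x \<and> b y = b x' \<or> r y = r x' \<and> b y = b x" if "y \<in> V" for y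
    using agree[OF x(1) that] agree[OF x(2) that] x by metis
  show ?thesis
  proof (cases "\<exists>\<rho> \<beta>. \<forall>y\<in>V. r y = \<rho> \<and> b y = \<beta>")
    case True
    then obtain \<rho> \<beta> where "\<forall>y\<in>V. r y = \<rho> \<and> b y = \<beta>" by blast
    then have "simple \<rho> \<beta> U V"
      using assms(1) unfolding simple_def joined_def covered_def by metis
    then show ?thesis by blast
  next
    case False
    then obtain y y' where y: "y \<in> V" "y' \<in> V"
      "r y = r x" "b y = b x'" "r y' = r x'" "b y' = b x"
      using V by metis
    have "(r u = r x \<or> r u = r x') \<and> (b u = b x \<or> b u = b x')" if "u \<in> U" for u
      using agree[OF that y(1)] agree[OF that y(2)] y x by metis
    then have "grid (U \<union> V)" unfolding grid_def using V by (metis Un_iff)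
    then show ?thesis by blast
  qed
qed

text \<open>If \<open>V\<close> has the red label \<rho> too, the edges that \<open>KR\<close>
  misses form a complete bipartite graph in blue, hence lie in one blue component. Otherwise a
  vertex of \<open>V\<close> with another red label reaches all of \<open>U\<close> in blue and so
  fixes the blue label.\<close>

lemma simple_if_red_constant:
  assumes "joined U V" "\<forall>x\<in>U. r x = \<rho>"
  shows "\<exists>\<rho> \<beta>. simple \<rho> \<beta> U V"
proof (cases "\<forall>y\<in>V. r y = \<rho>")
  case True
  show ?thesis
  proof (cases "U \<subseteq> KR \<or> V \<subseteq> KR")
    case red: True
    have "simple \<rho> \<beta> U V" for \<beta>
      using red True assms(2) unfolding simple_def covered_def by auto
    then show ?thesis by blast
  next
    case False
    then obtain x0 y0 where 0: "x0 \<in> U" "x0 \<notin> KR" "y0 \<in> V" "y0 \<notin> KR" by blast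
    have blue: "covered b KB x y" if "x \<in> U" "x \<notin> KR" "y \<in> V" "y \<notin> KR" for x y
      using assms(1) that unfolding joined_def covered_def by blast
    have b_const: "b x = b y0" if "x \<in> U" "x \<notin> KR" for x
      using blue[OF that 0(3,4)] by (simp add: covered_def)
    have "simple \<rho> (b y0) U V"
      unfolding simple_def
    proof (intro ballI)
      fix x y assume xy: "x \<in> U" "y \<in> V"
      show "covered r KR x y \<and> r x = \<rho> \<or> covered b KB x y \<and> b x = b y0"
      proof (cases "x \<in> KR \<or> y \<in> KR")
        case red: True
        then show ?thesis using xy True assms(2) by (auto simp: covered_def)
      next
        case False
        then show ?thesis using xy blue b_const by blast
      qed
    qed
    then show ?thesis by blast
  qed
next
  case False
  then obtain y where y: "y \<in> V" "r y \<noteq> \<rho>" by blast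
  then have "\<forall>x\<in>U. b x = b y"
    using assms unfolding joined_def covered_def by metis
  then have "simple \<rho> (b y) U V"
    using assms unfolding simple_def joined_def by metis
  then show ?thesis by blast
qed

lemma simple_if_blue_constant:
  assumes "joined U V" "\<forall>x\<in>U. b x = \<beta>"
  shows "\<exists>\<rho> \<beta>. simple \<rho> \<beta> U V"
proof -
  \<comment> \<open>Exchanging the two colours also exchanges the bounds \<open>s\<close> and
    \<open>t\<close>.\<close>
  interpret swap: two_covers b r KB KR t s
    by unfold_locales (simp_all add: fin red_le blue_le)
  have "swap.joined U V" using assms(1) unfolding joined_def swap.joined_def by blast
  from swap.simple_if_red_constant[OF this assms(2)] show ?thesis
    unfolding simple_def swap.simple_def by blast
qed

text \<open>Regard \<open>(r x, b x)\<close> as a point in a table. If any two points of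
  \<open>U\<close> share a row or a column, then all of them share one row or one column; otherwise
  two vertices differ in both labels.\<close>

lemma simple_or_grid:
  assumes "joined U V"
  shows "(\<exists>\<rho> \<beta>. simple \<rho> \<beta> U V) \<or> grid (U \<union> V)"
proof -
  show ?thesis
  proof (cases "\<exists>x\<in>U. \<exists>x'\<in>U. r x \<noteq> r x' \<and> b x \<noteq> b x'")
    case True
    then show ?thesis using simple_or_grid_disagreeing[OF assms] by blast
  next
    case agree: False
    show ?thesis
    proof (cases "\<exists>\<rho>. \<forall>x\<in>U. r x = \<rho>")
      case True
      then show ?thesis using simple_if_red_constant[OF assms] by blast
    next
      case False
      then obtain x x' where x: "x \<in> U" "x' \<in> U" "r x \<noteq> r x'" by blast
      have "b u = b x" if "u \<in> U" for u
      proof (cases "r u = r x")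
        case True
        then have "r u \<noteq> r x'" using x by simp
        then have "b u = b x'" "b x = b x'" using agree x that by blast+
        then show ?thesis by simp
      qed (use agree x that in blast)
      then show ?thesis using simple_if_blue_constant[OF assms] by blast
    qed
  qed
qed

text \<open>With both sides too big, a simple pair would fit \<open>U\<close> into one
  \<open>cov\<close>; in a grid, all vertices would be covered although there are at least
  \<open>2 * (s + t) + 2\<close> of them.\<close>

lemma joined_min:
  assumes "joined U V" "U \<inter> V = {}" "finite U" "finite V"
  shows "card U \<le> s + t \<or> card V \<le> s + t"
proof (rule ccontr)
  assume "\<not> ?thesis"
  then have big: "s + t < card U" "s + t < card V" by auto
  from simple_or_grid[OF assms(1)] show False
  proof
    assume "\<exists>\<rho> \<beta>. simple \<rho> \<beta> U V"
    then show False using simple_covers[OF _ big(2)] card_le_cov big(1) by (meson not_le)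
  next
    assume "grid (U \<union> V)"
    moreover have "U \<union> V \<subseteq> KR \<union> KB"
      using joined_covers[OF assms(1) big(2)] joined_covers[OF joined_sym[OF assms(1)] big(1)] by blast
    ultimately have "card (U \<union> V) \<le> 2 * (s + t)" by (rule grid_card)
    then show False using big card_Un_disjoint[of U V] assms by simp
  qed
qed

text \<open>The edges between \<open>A\<close> and \<open>B\<close> satisfy both conditions, and
  comparing the two pairs of labels puts \<open>A \<union> B\<close> into a single
  \<open>cov\<close>. If exactly one label is common, all these edges are covered in its component,
  whose cover then contains \<open>A\<close> or \<open>B\<close>.\<close>

lemma simple_pair:
  assumes K: "simple \<rho> \<beta> A V" "B \<subseteq> V" "s + t < card V"
    and L: "simple \<rho>' \<beta>' B U" "A \<subseteq> U" "s + t < card U"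
    and ne: "A \<noteq> {}" "B \<noteq> {}" and disj: "A \<inter> B = {}" "finite A" "finite B"
  shows "card A + card B \<le> s + t"
proof -
  have A: "A \<subseteq> cov \<rho> \<beta>" using simple_covers[OF K(1,3)] .
  have B: "B \<subseteq> cov \<rho>' \<beta>'" using simple_covers[OF L(1,3)] .
  have AB: "covered r KR x y \<and> r x = \<rho> \<or> covered b KB x y \<and> b x = \<beta>" if "x \<in> A" "y \<in> B" for x y
    using K that unfolding simple_def by blast
  have AB': "covered r KR x y \<and> r x = \<rho>' \<or> covered b KB x y \<and> b x = \<beta>'" if "x \<in> A" "y \<in> B" for x y
  proof -
    have "covered r KR y x \<and> r y = \<rho>' \<or> covered b KB y x \<and> b y = \<beta>'"
      using L that unfolding simple_def by blast
    then show ?thesis unfolding covered_def by auto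
  qed
  have "A \<union> B \<subseteq> cov \<rho> \<beta> \<or> A \<union> B \<subseteq> cov \<rho>' \<beta>' \<or> A \<union> B \<subseteq> cov \<rho> \<beta>' \<or> A \<union> B \<subseteq> cov \<rho>' \<beta>"
  proof -
    consider "\<rho> = \<rho>'" "\<beta> = \<beta>'" | "\<rho> = \<rho>'" "\<beta> \<noteq> \<beta>'" | "\<rho> \<noteq> \<rho>'" "\<beta> = \<beta>'" | "\<rho> \<noteq> \<rho>'" "\<beta> \<noteq> \<beta>'"
      by blast
    then show ?thesis
    proof cases
      case 1
      then show ?thesis using A B by simp
    next
      case 2
      have "covered r KR x y \<and> r x = \<rho>" if "x \<in> A" "y \<in> B" for x y
        using AB[OF that] AB'[OF that] 2 by auto
      from biclique_cover_side[OF this ne] show ?thesis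
      proof
        assume "A \<subseteq> {v \<in> KR. r v = \<rho>}"
        then have "A \<union> B \<subseteq> cov \<rho>' \<beta>'" using B 2 unfolding cov_def by auto
        then show ?thesis by simp
      next
        assume "B \<subseteq> {v \<in> KR. r v = \<rho>}"
        then have "A \<union> B \<subseteq> cov \<rho> \<beta>" using A unfolding cov_def by auto
        then show ?thesis by simp
      qed
    next
      case 3
      have "covered b KB x y \<and> b x = \<beta>" if "x \<in> A" "y \<in> B" for x y
        using AB[OF that] AB'[OF that] 3 by auto
      from biclique_cover_side[OF this ne] show ?thesis
      proof
        assume "A \<subseteq> {v \<in> KB. b v = \<beta>}"
        then have "A \<union> B \<subseteq> cov \<rho>' \<beta>'" using B 3 unfolding cov_def by auto
        then show ?thesis by simp
      next
        assume "B \<subseteq> {v \<in> KB. b v = \<beta>}"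
        then have "A \<union> B \<subseteq> cov \<rho> \<beta>" using A unfolding cov_def by auto
        then show ?thesis by simp
      qed
    next
      case 4
      \<comment> \<open>No edge can meet both conditions in the same colour, so it is covered in
        both colours, and both its ends carry both labels. One fixed edge then decides the
        alternative for all vertices.\<close>
      have alt: "r x = \<rho> \<and> r y = \<rho> \<and> b x = \<beta>' \<and> b y = \<beta>' \<or> r x = \<rho>' \<and> r y = \<rho>' \<and> b x = \<beta> \<and> b y = \<beta>"
        if "x \<in> A" "y \<in> B" for x y
        using AB[OF that] AB'[OF that] 4 unfolding covered_def by auto
      have "(\<forall>v\<in>A \<union> B. r v = \<rho> \<and> b v = \<beta>') \<or> (\<forall>v\<in>A \<union> B. r v = \<rho>' \<and> b v = \<beta>)"
      proof -
        obtain x0 y0 where 0: "x0 \<in> A" "y0 \<in> B" using ne by blast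
        have "r v = r x0 \<and> b v = b x0" if "v \<in> A \<union> B" for v
          using that alt[OF 0] alt[OF _ 0(2), of v] alt[OF 0(1), of v] 4 by auto
        then show ?thesis using alt[OF 0] by auto
      qed
      then show ?thesis
      proof
        assume *: "\<forall>v\<in>A \<union> B. r v = \<rho> \<and> b v = \<beta>'"
        then have "A \<union> B \<subseteq> cov \<rho> \<beta>'" using A B 4 unfolding cov_def by auto
        then show ?thesis by blast
      next
        assume *: "\<forall>v\<in>A \<union> B. r v = \<rho>' \<and> b v = \<beta>"
        then have "A \<union> B \<subseteq> cov \<rho>' \<beta>" using A B 4 unfolding cov_def by auto
        then show ?thesis by blast
      qed
    qed
  qed
  then show ?thesis
    using card_le_cov[of "A \<union> B"] card_Un_disjoint[of A B] disj by auto
qed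

text \<open>The parts form a path \<open>U\<close>, \<open>B\<close>, \<open>A\<close>,
  \<open>V\<close>. If both pairs around the middle were simple, \<open>simple_pair\<close> would
  bound \<open>card A + card B\<close> by \<open>s + t\<close>; so one of them is a grid, consisting
  of covered vertices only.\<close>

lemma joined_corner:
  assumes AV: "joined A (B \<union> V)" and UB: "joined (A \<union> U) B"
    and big: "s + t < card B + card V" "s + t < card A + card U" "s + t < card A + card B"
    and sub: "U \<subseteq> KR \<union> KB" "V \<subseteq> KR \<union> KB"
    and ne: "A \<noteq> {}" "B \<noteq> {}" and fins: "finite A" "finite B" "finite U" "finite V"
    and disj: "A \<inter> U = {}" "B \<inter> V = {}" "(A \<union> U) \<inter> (B \<union> V) = {}"
  shows "card A + card B + card V \<le> 2 * (s + t) \<or> card A + card B + card U \<le> 2 * (s + t)"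
proof -
  have BA: "joined B (A \<union> U)" using joined_sym[OF UB] .
  have cards: "card (B \<union> V) = card B + card V" "card (A \<union> U) = card A + card U"
    using disj fins by (simp_all add: card_Un_disjoint)
  have A: "A \<subseteq> KR \<union> KB" using joined_covers[OF AV] big cards by simp
  have B: "B \<subseteq> KR \<union> KB" using joined_covers[OF BA] big cards by simp
  have "\<not> (simple \<rho> \<beta> A (B \<union> V) \<and> simple \<rho>' \<beta>' B (A \<union> U))" for \<rho> \<beta> \<rho>' \<beta>'
    using simple_pair[of \<rho> \<beta> A "B \<union> V" B \<rho>' \<beta>' "A \<union> U"] big cards ne fins disj by fastforce
  then consider "grid (A \<union> (B \<union> V))" | "grid (B \<union> (A \<union> U))"
    using simple_or_grid[OF AV] simple_or_grid[OF BA] by blast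
  then show ?thesis
  proof cases
    case 1
    then have "card (A \<union> (B \<union> V)) \<le> 2 * (s + t)" by (rule grid_card) (use A B sub in blast)
    moreover have "card (A \<union> (B \<union> V)) = card A + card (B \<union> V)"
      using disj fins by (intro card_Un_disjoint) auto
    ultimately show ?thesis using cards by simp
  next
    case 2
    then have "card (B \<union> (A \<union> U)) \<le> 2 * (s + t)" by (rule grid_card) (use A B sub in blast)
    moreover have "card (B \<union> (A \<union> U)) = card B + card (A \<union> U)"
      using disj fins by (intro card_Un_disjoint) auto
    ultimately show ?thesis using cards by simp
  qed
qed

section \<open>Two impossible arrangements of joined parts\<close>

text \<open>The path is \<open>A1\<close>, \<open>B2\<close>, \<open>A3\<close>, \<open>B1\<close>,
  \<open>A2\<close>, \<open>B3\<close>. The parts \<open>A2\<close> and \<open>B2\<close> are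
  covered because their neighbours are large, so \<open>joined_corner\<close> applies to the inner
  four parts.\<close>

lemma no_joined_path:
  assumes joins: "joined A1 B2" "joined A3 (B1 \<union> B2)" "joined (A2 \<union> A3) B1" "joined A2 B3"
    and fins: "finite A1" "finite A2" "finite A3" "finite B1" "finite B2" "finite B3"
    and disj: "A1 \<inter> A2 = {}" "A1 \<inter> A3 = {}" "A2 \<inter> A3 = {}" "B1 \<inter> B2 = {}" "B1 \<inter> B3 = {}"
      "B2 \<inter> B3 = {}" "(A1 \<union> A2 \<union> A3) \<inter> (B1 \<union> B2 \<union> B3) = {}"
    and cards: "card A1 + card A2 + card A3 = 2 * (s + t) + 1"
      "card B1 + card B2 + card B3 = 2 * (s + t) + 1"
    and ends: "card A1 + card B3 \<le> s + t"
    and large: "s + t < card A1 + card A3" "s + t < card B1 + card B3"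
  shows False
proof -
  have "joined A2 (B1 \<union> B3)" using joins unfolding joined_def by blast
  then have A2: "A2 \<subseteq> KR \<union> KB"
    by (rule joined_covers) (use large fins disj in \<open>simp add: card_Un_disjoint\<close>)
  have "joined (A1 \<union> A3) B2" using joins unfolding joined_def by blast
  then have B2: "B2 \<subseteq> KR \<union> KB"
    by (intro joined_covers[OF joined_sym]) (use large fins disj in \<open>auto simp: card_Un_disjoint\<close>)
  have ne: "A3 \<noteq> {}" "B1 \<noteq> {}" using ends large by auto
  have j: "joined (A3 \<union> A2) B1" using joins by (simp add: Un_commute)
  have d: "A3 \<inter> A2 = {}" "B1 \<inter> B2 = {}" "(A3 \<union> A2) \<inter> (B1 \<union> B2) = {}" using disj by blast+
  have big: "s + t < card B1 + card B2" "s + t < card A3 + card A2" "s + t < card A3 + card B1"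
    using cards ends large by simp_all
  have "card A3 + card B1 + card B2 \<le> 2 * (s + t) \<or> card A3 + card B1 + card A2 \<le> 2 * (s + t)"
    by (rule joined_corner[OF joins(2) j big A2 B2 ne fins(3,4,2,5) d])
  \<comment> \<open>By the totals, the alternatives mean \<open>card A3 < card B3\<close> and
    \<open>card B1 < card A1\<close>. With \<open>ends\<close>, either one contradicts
    \<open>large\<close>.\<close>
  then show False using cards ends large by linarith
qed

text \<open>In the cyclic order \<open>S1\<close>, \<open>T2\<close>, \<open>S3\<close>,
  \<open>T1\<close>, \<open>S2\<close>, \<open>T3\<close>, each \<open>Si\<close> is opposite to
  \<open>Ti\<close>. Applied around two neighbouring parts, \<open>joined_corner\<close> compares
  the sizes of opposite parts; the six comparisons contradict the equal totals.\<close>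

lemma no_joined_hexagon:
  assumes joins: "joined S1 (T2 \<union> T3)" "joined S2 (T1 \<union> T3)" "joined S3 (T1 \<union> T2)"
    and fins: "finite S1" "finite S2" "finite S3" "finite T1" "finite T2" "finite T3"
    and disj: "S1 \<inter> S2 = {}" "S1 \<inter> S3 = {}" "S2 \<inter> S3 = {}" "T1 \<inter> T2 = {}" "T1 \<inter> T3 = {}"
      "T2 \<inter> T3 = {}" "(S1 \<union> S2 \<union> S3) \<inter> (T1 \<union> T2 \<union> T3) = {}"
    and cards: "card S1 + card S2 + card S3 = 2 * (s + t) + 1"
      "card T1 + card T2 + card T3 = 2 * (s + t) + 1"
    and small: "card S1 \<le> s + t" "card S2 \<le> s + t" "card S3 \<le> s + t"
      "card T1 \<le> s + t" "card T2 \<le> s + t" "card T3 \<le> s + t"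
  shows False
proof -
  \<comment> \<open>Dropping the block between two parts that are small together leaves a path.\<close>
  have step: "card S < card T \<or> card T' < card S'"
    if j: "joined S (T' \<union> T'')" "joined S' (T \<union> T'')" "joined S'' (T \<union> T')"
      and f: "finite S" "finite S'" "finite S''" "finite T" "finite T'" "finite T''"
      and d: "S \<inter> S' = {}" "S \<inter> S'' = {}" "S' \<inter> S'' = {}" "T \<inter> T' = {}" "T \<inter> T'' = {}"
        "T' \<inter> T'' = {}" "(S \<union> S' \<union> S'') \<inter> (T \<union> T' \<union> T'') = {}"
      and c: "card S + card S' + card S'' = 2 * (s + t) + 1"
        "card T + card T' + card T'' = 2 * (s + t) + 1"
      and m: "card S \<le> s + t" "card S' \<le> s + t" "card S'' \<le> s + t"
        "card T \<le> s + t" "card T' \<le> s + t" "card T'' \<le> s + t"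
    for S S' S'' T T' T''
  proof -
    have pair: "s + t < card S + card T'"
    proof (rule ccontr)
      assume not_pair: "\<not> ?thesis"
      show False
      proof (rule no_joined_path[of S T'' S' T S'' T'])
        show "joined S T''" "joined S' (T \<union> T'')" "joined (S'' \<union> S') T" "joined S'' T'"
          using j unfolding joined_def by blast+
        show "(S \<union> S'' \<union> S') \<inter> (T \<union> T'' \<union> T') = {}" using d by blast
      qed (use f d c m not_pair in \<open>simp_all add: Int_commute\<close>)
    qed
    have S'': "S'' \<subseteq> KR \<union> KB"
      by (rule joined_covers[OF j(3)]) (use c m f d in \<open>simp add: card_Un_disjoint\<close>)
    have "joined (S \<union> S') T''" using j unfolding joined_def by blast
    then have T'': "T'' \<subseteq> KR \<union> KB"
      by (intro joined_covers[OF joined_sym]) (use c m f d in \<open>auto simp: card_Un_disjoint\<close>)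
    have j': "joined (S \<union> S'') T'" using j unfolding joined_def by blast
    have ne: "S \<noteq> {}" "T' \<noteq> {}" using pair m by auto
    have d': "S \<inter> S'' = {}" "T' \<inter> T'' = {}" "(S \<union> S'') \<inter> (T' \<union> T'') = {}" using d by blast+
    have big: "s + t < card T' + card T''" "s + t < card S + card S''" using c m by simp_all
    have "card S + card T' + card T'' \<le> 2 * (s + t) \<or> card S + card T' + card S'' \<le> 2 * (s + t)"
      by (rule joined_corner[OF j(1) j' big pair S'' T'' ne f(1,5,3,6) d'])
    then show ?thesis using c by linarith
  qed
  have 12: "card S1 < card T1 \<or> card T2 < card S2"
    by (rule step[of S1 T2 T3 S2 T1 S3]) (use assms in \<open>auto simp: Un_commute\<close>)
  have 13: "card S1 < card T1 \<or> card T3 < card S3"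
    by (rule step[of S1 T3 T2 S3 T1 S2]) (use assms in \<open>auto simp: Un_commute\<close>)
  have 21: "card S2 < card T2 \<or> card T1 < card S1"
    by (rule step[of S2 T1 T3 S1 T2 S3]) (use assms in \<open>auto simp: Un_commute\<close>)
  have 23: "card S2 < card T2 \<or> card T3 < card S3"
    by (rule step[of S2 T3 T1 S3 T2 S1]) (use assms in \<open>auto simp: Un_commute\<close>)
  have 31: "card S3 < card T3 \<or> card T1 < card S1"
    by (rule step[of S3 T1 T2 S1 T3 S2]) (use assms in \<open>auto simp: Un_commute\<close>)
  have 32: "card S3 < card T3 \<or> card T2 < card S2"
    by (rule step[of S3 T2 T1 S2 T3 S1]) (use assms in \<open>auto simp: Un_commute\<close>)
  \<comment> \<open>The differences \<open>card Si - card Ti\<close> add up to 0, so one of them is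
    nonnegative. This makes the other two positive, and these in turn make the first
    positive.\<close>
  show False using 12 13 21 23 31 32 cards by linarith
qed

section \<open>Grouping the green components\<close>

lemma no_three_covers:
  assumes KG: "finite KG" "\<And>\<gamma>. card {v \<in> KG. g v = \<gamma>} \<le> s + t"
    and XY: "finite X" "finite Y" "X \<inter> Y = {}" "card X = 2 * (s + t) + 1" "card Y = 2 * (s + t) + 1"
    and cov: "\<And>x y. x \<in> X \<Longrightarrow> y \<in> Y \<Longrightarrow> covered r KR x y \<or> covered b KB x y \<or> covered g KG x y"
  shows False
proof -
  define S where "S \<Lambda> = {x \<in> X. g x \<in> \<Lambda>}" for \<Lambda>
  define T where "T \<Lambda> = {y \<in> Y. g y \<in> \<Lambda>}" for \<Lambda>
  define large where "large \<Lambda> \<longleftrightarrow> s + t < card (S \<Lambda>) \<and> s + t < card (T \<Lambda>)" for \<Lambda>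
  have fins: "finite (S \<Lambda>)" "finite (T \<Lambda>)" for \<Lambda> using XY(1,2) by (auto simp: S_def T_def)
  have ST: "S \<Lambda> \<inter> T \<Lambda>' = {}" for \<Lambda> \<Lambda>' using XY(3) by (auto simp: S_def T_def)
  have joins: "joined (S \<Lambda>) (T \<Lambda>')" if "\<Lambda> \<inter> \<Lambda>' = {}" for \<Lambda> \<Lambda>'
    unfolding joined_def
  proof (intro ballI)
    fix x y assume xy: "x \<in> S \<Lambda>" "y \<in> T \<Lambda>'"
    then have "g x \<noteq> g y" using that by (auto simp: S_def T_def)
    then have "\<not> covered g KG x y" by (simp add: covered_def)
    moreover have "x \<in> X" "y \<in> Y" using xy by (simp_all add: S_def T_def)
    ultimately show "covered r KR x y \<or> covered b KB x y" using cov by blast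
  qed
  have S_add: "card (S (\<Lambda> \<union> \<Lambda>')) = card (S \<Lambda>) + card (S \<Lambda>')" if "\<Lambda> \<inter> \<Lambda>' = {}" for \<Lambda> \<Lambda>'
  proof -
    have "S (\<Lambda> \<union> \<Lambda>') = S \<Lambda> \<union> S \<Lambda>'" "S \<Lambda> \<inter> S \<Lambda>' = {}" using that by (auto simp: S_def)
    then show ?thesis by (simp add: card_Un_disjoint fins)
  qed
  have T_add: "card (T (\<Lambda> \<union> \<Lambda>')) = card (T \<Lambda>) + card (T \<Lambda>')" if "\<Lambda> \<inter> \<Lambda>' = {}" for \<Lambda> \<Lambda>'
  proof -
    have "T (\<Lambda> \<union> \<Lambda>') = T \<Lambda> \<union> T \<Lambda>'" "T \<Lambda> \<inter> T \<Lambda>' = {}" using that by (auto simp: T_def)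
    then show ?thesis by (simp add: card_Un_disjoint fins)
  qed
  have univ: "card (S UNIV) = 2 * (s + t) + 1" "card (T UNIV) = 2 * (s + t) + 1"
    using XY by (simp_all add: S_def T_def)
  have compl: "card (S \<Lambda>) + card (S (- \<Lambda>)) = 2 * (s + t) + 1"
    "card (T \<Lambda>) + card (T (- \<Lambda>)) = 2 * (s + t) + 1" for \<Lambda>
    using S_add[of \<Lambda> "- \<Lambda>"] T_add[of \<Lambda> "- \<Lambda>"] univ by simp_all
  \<comment> \<open>By \<open>joined_min\<close> and the odd total, \<open>S \<Lambda>\<close>
    exceeds \<open>s + t\<close> iff \<open>T \<Lambda>\<close> does.\<close>
  have small: "card (S \<Lambda>) \<le> s + t \<and> card (T \<Lambda>) \<le> s + t" if "\<not> large \<Lambda>" for \<Lambda>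
  proof -
    have "card (S \<Lambda>) \<le> s + t \<or> card (T (- \<Lambda>)) \<le> s + t"
      by (rule joined_min) (simp_all add: joins fins ST)
    moreover have "card (S (- \<Lambda>)) \<le> s + t \<or> card (T \<Lambda>) \<le> s + t"
      by (rule joined_min) (simp_all add: joins fins ST)
    ultimately show ?thesis using compl[of \<Lambda>] that unfolding large_def by presburger
  qed
  have "S (g ` (X \<union> Y)) = X" "T (g ` (X \<union> Y)) = Y" by (auto simp: S_def T_def)
  then have full: "large (g ` (X \<union> Y))" using XY by (simp add: large_def)
  \<comment> \<open>In a large label set of least cardinality, removing one label \<gamma> leaves a
    set that is not large; the complement of a large set is small on both sides.\<close>
  define P where "P \<Lambda> \<longleftrightarrow> finite \<Lambda> \<and> large \<Lambda>" for \<Lambda>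
  have "P (g ` (X \<union> Y))" using full XY(1,2) by (simp add: P_def)
  from ex_has_least_nat[of P, OF this, of card] obtain \<Lambda>
    where "P \<Lambda>" and min: "\<And>\<Lambda>'. P \<Lambda>' \<Longrightarrow> card \<Lambda> \<le> card \<Lambda>'"
    by blast
  then have \<Lambda>: "finite \<Lambda>" "large \<Lambda>" by (simp_all add: P_def)
  have "S {} = {}" by (simp add: S_def)
  then have "\<Lambda> \<noteq> {}" using \<Lambda>(2) by (auto simp: large_def)
  then obtain \<gamma> where \<gamma>: "\<gamma> \<in> \<Lambda>" by blast
  show False
  proof (cases "large {\<gamma>}")
    case True
    have S_split: "card (S {\<gamma>} \<inter> KG) + card (S {\<gamma>} - KG) = card (S {\<gamma>})"
      by (rule card_Int_Diff[symmetric]) (rule fins)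
    have T_split: "card (T {\<gamma>} \<inter> KG) + card (T {\<gamma>} - KG) = card (T {\<gamma>})"
      by (rule card_Int_Diff[symmetric]) (rule fins)
    \<comment> \<open>The two end parts of the path are the left and right vertices in the cover of
      component \<gamma>, so their sizes add up to at most \<open>s + t\<close>. Outside that cover,
      the component has no green edges.\<close>
    show False
    proof (rule no_joined_path)
      show "joined (S {\<gamma>} \<inter> KG) (T (- {\<gamma>}))" "joined (S (- {\<gamma>})) (T {\<gamma>} \<inter> KG)"
        using joins[of "{\<gamma>}" "- {\<gamma>}"] joins[of "- {\<gamma>}" "{\<gamma>}"] unfolding joined_def by blast+
      have inner: "joined (S {\<gamma>} - KG) (T {\<gamma>} - KG)"
        unfolding joined_def
      proof (intro ballI)
        fix x y assume xy: "x \<in> S {\<gamma>} - KG" "y \<in> T {\<gamma>} - KG"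
        then have "\<not> covered g KG x y" by (simp add: covered_def)
        moreover have "x \<in> X" "y \<in> Y" using xy by (simp_all add: S_def T_def)
        ultimately show "covered r KR x y \<or> covered b KB x y" using cov by blast
      qed
      show "joined (S {\<gamma>} - KG) ((T {\<gamma>} - KG) \<union> T (- {\<gamma>}))"
        using inner joins[of "{\<gamma>}" "- {\<gamma>}"] unfolding joined_def by blast
      show "joined (S (- {\<gamma>}) \<union> (S {\<gamma>} - KG)) (T {\<gamma>} - KG)"
        using inner joins[of "- {\<gamma>}" "{\<gamma>}"] unfolding joined_def by blast
      have "card (S {\<gamma>} \<inter> KG) + card (T {\<gamma>} \<inter> KG) = card ((S {\<gamma>} \<inter> KG) \<union> (T {\<gamma>} \<inter> KG))"
        by (rule card_Un_disjoint[symmetric]) (use fins ST[of "{\<gamma>}" "{\<gamma>}"] in auto)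
      also have "\<dots> \<le> card {v \<in> KG. g v = \<gamma>}"
        by (rule card_mono) (use KG in \<open>auto simp: S_def T_def\<close>)
      finally show "card (S {\<gamma>} \<inter> KG) + card (T {\<gamma>} \<inter> KG) \<le> s + t" using KG(2)[of \<gamma>] by linarith
      show "card (S {\<gamma>} \<inter> KG) + card (S (- {\<gamma>})) + card (S {\<gamma>} - KG) = 2 * (s + t) + 1"
        "card (T {\<gamma>} - KG) + card (T (- {\<gamma>})) + card (T {\<gamma>} \<inter> KG) = 2 * (s + t) + 1"
        using S_split T_split compl[of "{\<gamma>}"] by simp_all
      show "s + t < card (S {\<gamma>} \<inter> KG) + card (S {\<gamma>} - KG)"
        "s + t < card (T {\<gamma>} - KG) + card (T {\<gamma>} \<inter> KG)"
        using S_split T_split True unfolding large_def by simp_all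
    qed (use XY(1-3) in \<open>auto simp: S_def T_def\<close>)
  next
    case False
    \<comment> \<open>The three groups of labels are \<open>{\<gamma>}\<close>,
      \<open>\<Lambda> - {\<gamma>}\<close> and \<open>- \<Lambda>\<close>.\<close>
    have "card (\<Lambda> - {\<gamma>}) < card \<Lambda>" using \<gamma> \<Lambda> by (intro card_Diff1_less)
    then have False': "\<not> large (\<Lambda> - {\<gamma>})"
      using min[of "\<Lambda> - {\<gamma>}"] \<Lambda>(1) by (auto simp: P_def)
    have \<Lambda>_eq: "{\<gamma>} \<union> (\<Lambda> - {\<gamma>}) = \<Lambda>" using \<gamma> by blast
    have sums: "card (S {\<gamma>}) + card (S (\<Lambda> - {\<gamma>})) = card (S \<Lambda>)"
      "card (T {\<gamma>}) + card (T (\<Lambda> - {\<gamma>})) = card (T \<Lambda>)"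
      using S_add[of "{\<gamma>}" "\<Lambda> - {\<gamma>}"] T_add[of "{\<gamma>}" "\<Lambda> - {\<gamma>}"] unfolding \<Lambda>_eq by auto
    have T_Un: "T \<Lambda>1 \<union> T \<Lambda>2 = T (\<Lambda>1 \<union> \<Lambda>2)" for \<Lambda>1 \<Lambda>2 by (auto simp: T_def)
    show False
    proof (rule no_joined_hexagon)
      show "joined (S {\<gamma>}) (T (\<Lambda> - {\<gamma>}) \<union> T (- \<Lambda>))" "joined (S (\<Lambda> - {\<gamma>})) (T {\<gamma>} \<union> T (- \<Lambda>))"
        "joined (S (- \<Lambda>)) (T {\<gamma>} \<union> T (\<Lambda> - {\<gamma>}))"
        unfolding T_Un by (rule joins; use \<gamma> in blast)+
      show "card (S {\<gamma>}) + card (S (\<Lambda> - {\<gamma>})) + card (S (- \<Lambda>)) = 2 * (s + t) + 1"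
        "card (T {\<gamma>}) + card (T (\<Lambda> - {\<gamma>})) + card (T (- \<Lambda>)) = 2 * (s + t) + 1"
        using sums compl[of \<Lambda>] by simp_all
      show "card (S (- \<Lambda>)) \<le> s + t" "card (T (- \<Lambda>)) \<le> s + t"
        using compl[of \<Lambda>] \<Lambda>(2) unfolding large_def by simp_all
    qed (use XY(1-3) \<gamma> small[OF False] small[OF False'] in \<open>auto simp: S_def T_def\<close>)
  qed
qed

end


section \<open>Connected matchings and vertex covers of components\<close>

definition component :: "'a graph \<Rightarrow> 'a \<Rightarrow> 'a set" where
  "component G u = {v \<in> verts G. reachable G u v}"

text \<open>Choosing a cover vertex in each edge is injective on a matching, as its edges are
  disjoint.\<close>

lemma matching_number_le_cover:
  assumes "finite (edges G)" "finite C" and cover: "\<And>e. e \<in> edges G \<Longrightarrow> e \<inter> C \<noteq> {}"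
  shows "matching_number G \<le> card C"
proof -
  have "card M \<le> card C" if M: "is_matching G M" for M
  proof (rule card_inj_on_le)
    define pick where "pick e = (SOME v. v \<in> e \<inter> C)" for e :: "'a set"
    have pick: "pick e \<in> e \<inter> C" if "e \<in> M" for e
    proof -
      have "e \<inter> C \<noteq> {}" using cover M that unfolding is_matching_def by blast
      then show ?thesis unfolding pick_def by (rule some_in_eq[THEN iffD2])
    qed
    then show "pick ` M \<subseteq> C" by blast
    show "inj_on pick M"
    proof (rule inj_onI, rule ccontr)
      fix e e' assume e: "e \<in> M" "e' \<in> M" "pick e = pick e'" "e \<noteq> e'"
      then have "e \<inter> e' = {}" using M unfolding is_matching_def by (auto dest: disjointD)
      then show False using pick[OF e(1)] pick[OF e(2)] e(3) by auto
    qed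
  qed fact
  moreover have "finite {card M |M. is_matching G M}"
    using assms(1) by (auto simp: is_matching_def)
  moreover have "is_matching G {}" by (simp add: is_matching_def disjoint_def)
  ultimately show ?thesis unfolding matching_number_def by (subst Max_le_iff) auto
qed

text \<open>The hard half of the duality, carried over from pairs to two-element edges by the
  injection \<open>edge\<close>.\<close>

lemma cover_less_if_matching_number_less:
  fixes G :: "('a + 'b) graph"
  assumes "finite (edges G)" and bip: "\<And>e. e \<in> edges G \<Longrightarrow> \<exists>i j. e = {Inl i, Inr j}"
    and "matching_number G < t"
  shows "\<exists>C. finite C \<and> card C < t \<and> (\<forall>e\<in>edges G. e \<inter> C \<noteq> {})"
proof (rule ccontr)
  assume no: "\<not> ?thesis"
  define edge :: "'a \<times> 'b \<Rightarrow> ('a + 'b) set" where "edge = (\<lambda>(i, j). {Inl i, Inr j})"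
  have inj: "inj edge" by (auto simp: inj_on_def edge_def doubleton_eq_iff)
  define E where "E = edge -` edges G"
  have "\<exists>M\<subseteq>E. inj_on fst M \<and> inj_on snd M \<and> t \<le> card M"
  proof (rule koenig)
    show "finite E" unfolding E_def by (rule finite_vimageI) (use assms(1) inj in auto)
    fix P Q assume PQ: "finite P" "finite Q" "\<And>x y. (x, y) \<in> E \<Longrightarrow> x \<in> P \<or> y \<in> Q"
    have "e \<inter> (P <+> Q) \<noteq> {}" if e: "e \<in> edges G" for e
    proof -
      obtain i j where ij: "e = {Inl i, Inr j}" using bip[OF e] by blast
      then have "i \<in> P \<or> j \<in> Q" using PQ(3) e by (simp add: E_def edge_def)
      then show ?thesis using ij by auto
    qed
    moreover have "finite (P <+> Q)" using PQ by simp
    ultimately have "t \<le> card (P <+> Q)" using no by (meson not_le)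
    then show "t \<le> card P + card Q" using PQ by (simp add: card_Plus)
  qed
  then obtain M where M: "M \<subseteq> E" "inj_on fst M" "inj_on snd M" "t \<le> card M" by blast
  have "disjoint (edge ` M)"
  proof (rule disjointI)
    fix e e' assume "e \<in> edge ` M" "e' \<in> edge ` M" and ne: "e \<noteq> e'"
    then obtain p p' where p: "p \<in> M" "p' \<in> M" "e = edge p" "e' = edge p'" by blast
    then have "fst p \<noteq> fst p'" "snd p \<noteq> snd p'" using ne M by (auto dest: inj_onD)
    then show "e \<inter> e' = {}" using p by (auto simp: edge_def split: prod.splits)
  qed
  then have "is_matching G (edge ` M)" using M(1) by (auto simp: is_matching_def E_def)
  moreover have "card (edge ` M) = card M" by (rule card_image) (rule inj_on_subset[OF inj], simp)
  moreover have "finite {card M |M. is_matching G M}"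
    using assms(1) by (auto simp: is_matching_def)
  ultimately have "card M \<le> matching_number G"
    unfolding matching_number_def by (metis (mono_tags, lifting) Max_ge mem_Collect_eq)
  then show False using M assms by simp
qed

lemma reachable_sym:
  assumes "reachable G u v" shows "reachable G v u"
proof -
  have "sym {(x, y). {x, y} \<in> edges G}" by (auto intro!: symI simp: insert_commute)
  then show ?thesis using assms unfolding reachable_def by (meson sym_rtrancl symD)
qed

lemma reachable_trans: "reachable G u v \<Longrightarrow> reachable G v w \<Longrightarrow> reachable G u w"
  unfolding reachable_def by (rule rtrancl_trans)

lemma reachable_edge: "{u, v} \<in> edges G \<Longrightarrow> reachable G u v"
  unfolding reachable_def by blast

lemma component_eq:
  assumes "reachable G u v" shows "component G u = component G v"
  using assms reachable_sym[OF assms] by (auto simp: component_def intro: reachable_trans)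

lemma components_eq: "components G = (\<lambda>u. induced G (component G u)) ` verts G"
  by (auto simp: components_def component_def)

lemma edges_induced: "edges (induced G C) = {e \<in> edges G. e \<subseteq> C}"
  by (simp add: edges_def induced_def)

text \<open>Each vertex is labelled by the vertex set of its component, and \<open>K\<close>
  collects small covers of all components.\<close>

lemma cover_if_no_connected_matching:
  fixes G :: "('a + 'b) graph"
  assumes fin: "finite (verts G)" "finite (edges G)"
    and bip: "\<And>e. e \<in> edges G \<Longrightarrow> \<exists>i j. e = {Inl i, Inr j}"
    and sub: "\<And>e. e \<in> edges G \<Longrightarrow> e \<subseteq> verts G"
    and no: "\<not> has_connected_matching G f c t"
  shows "\<exists>(lab :: 'a + 'b \<Rightarrow> ('a + 'b) set) K. finite K \<and> (\<forall>\<mu>. card {v \<in> K. lab v = \<mu>} \<le> t - 1) \<and>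
    (\<forall>x y. {x, y} \<in> edges G \<longrightarrow> f {x, y} = c \<longrightarrow> covered lab K x y)"
proof -
  define H where "H = colour_subgraph G f c"
  have H: "verts H = verts G" "edges H = {e \<in> edges G. f e = c}"
    by (simp_all add: H_def colour_subgraph_def verts_def edges_def)
  have "\<exists>C. finite C \<and> card C < t \<and> (\<forall>e\<in>edges (induced H (component H u)). e \<inter> C \<noteq> {})" if "u \<in> verts H" for u
  proof (rule cover_less_if_matching_number_less)
    have "induced H (component H u) \<in> components H" using that by (simp add: components_eq)
    then show "matching_number (induced H (component H u)) < t"
      using no unfolding has_connected_matching_def H_def by (meson not_le)
  qed (use fin bip in \<open>auto simp: edges_induced H\<close>)
  \<comment> \<open>Choosing per component, not per vertex, gives all vertices of a component the
    same cover.\<close>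
  then have "\<forall>\<mu>\<in>component H ` verts H. \<exists>C. finite C \<and> card C < t \<and> (\<forall>e\<in>edges (induced H \<mu>). e \<inter> C \<noteq> {})"
    by blast
  from bchoice[OF this] obtain C
    where C: "\<And>u. u \<in> verts H \<Longrightarrow> finite (C (component H u)) \<and> card (C (component H u)) < t"
      "\<And>u e. u \<in> verts H \<Longrightarrow> e \<in> edges (induced H (component H u)) \<Longrightarrow>
        e \<inter> C (component H u) \<noteq> {}"
    by blast
  \<comment> \<open>Only vertices in the cover of their own component are kept, so the part of
    \<open>K\<close> with label \<mu> lies in \<open>C \<mu>\<close>.\<close>
  define K where "K = {v \<in> verts H. v \<in> C (component H v)}"
  have "card {v \<in> K. component H v = \<mu>} \<le> t - 1" for \<mu>
  proof (cases "\<mu> \<in> component H ` verts H")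
    case True
    then obtain u where u: "u \<in> verts H" "\<mu> = component H u" by blast
    have le: "card {v \<in> K. component H v = \<mu>} \<le> card (C \<mu>)"
      by (rule card_mono) (use C(1)[OF u(1)] u(2) in \<open>auto simp: K_def\<close>)
    have "card (C \<mu>) < t" using C(1)[OF u(1)] u(2) by simp
    with le show ?thesis by linarith
  next
    case False
    then have "{v \<in> K. component H v = \<mu>} = {}" by (auto simp: K_def)
    then show ?thesis by (metis card.empty zero_le)
  qed
  moreover have "covered (component H) K x y" if "{x, y} \<in> edges G" "f {x, y} = c" for x y
  proof -
    have e: "{x, y} \<in> edges H" using that H by simp
    have xy: "x \<in> verts H" "y \<in> verts H" using sub[OF that(1)] H by auto
    have eq: "component H x = component H y" using e by (intro component_eq reachable_edge)
    have "reachable H x x" by (simp add: reachable_def)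
    then have "{x, y} \<subseteq> component H x" using xy reachable_edge[OF e] by (simp add: component_def)
    then have "{x, y} \<in> edges (induced H (component H x))" using e by (simp add: edges_induced)
    then have "{x, y} \<inter> C (component H x) \<noteq> {}" by (rule C(2)[OF xy(1)])
    then show ?thesis using xy eq by (auto simp: covered_def K_def)
  qed
  moreover have "finite K" using fin H by (simp add: K_def)
  ultimately show ?thesis by blast
qed

text \<open>Labels are constant along edges of colour \<open>c\<close>, so a component lies in one
  label class, and the part of \<open>K\<close> in that class covers it. A class may contain several
  components.\<close>

lemma no_connected_matching_if_cover:
  assumes fin: "finite (edges G)" "finite K"
    and pairs: "\<And>e. e \<in> edges G \<Longrightarrow> \<exists>x y. e = {x, y}"
    and K: "\<And>\<mu>. card {v \<in> K. lab v = \<mu>} < t"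
    and cov: "\<And>x y. {x, y} \<in> edges G \<Longrightarrow> f {x, y} = c \<Longrightarrow> covered lab K x y"
  shows "\<not> has_connected_matching G f c t"
proof -
  define H where "H = colour_subgraph G f c"
  have H: "verts H = verts G" "edges H = {e \<in> edges G. f e = c}"
    by (simp_all add: H_def colour_subgraph_def verts_def edges_def)
  have lab: "lab v = lab u" if "reachable H u v" for u v
    using that unfolding reachable_def
  proof (induction rule: rtrancl_induct)
    case (step y z)
    then have "covered lab K y z" using cov H by simp
    then show ?case using step by (simp add: covered_def)
  qed simp
  have "matching_number (induced H (component H u)) < t" for u
  proof -
    have "matching_number (induced H (component H u)) \<le> card {v \<in> K. lab v = lab u}"
    proof (rule matching_number_le_cover)
      fix e assume e: "e \<in> edges (induced H (component H u))"
      then have "e \<in> edges G" by (simp add: edges_induced H)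
      then obtain x y where xy: "e = {x, y}" using pairs by blast
      then have "covered lab K x y" using cov e H by (simp add: edges_induced)
      moreover have "lab x = lab u" "lab y = lab u"
        using e xy lab by (auto simp: edges_induced component_def)
      ultimately show "e \<inter> {v \<in> K. lab v = lab u} \<noteq> {}" using xy by (auto simp: covered_def)
    qed (use fin in \<open>auto simp: edges_induced H\<close>)
    then show ?thesis using K[of "lab u"] by linarith
  qed
  then show ?thesis
    unfolding has_connected_matching_def H_def[symmetric] by (simp add: components_eq not_le)
qed

lemma edges_complete_bipartite:
  "edges (complete_bipartite n m) = (\<lambda>(i, j). {Inl i, Inr j}) ` ({..<n} \<times> {..<m})"
  by (auto simp: edges_def complete_bipartite_def)

lemma verts_complete_bipartite: "verts (complete_bipartite n m) = {..<n} <+> {..<m}"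
  by (simp add: verts_def complete_bipartite_def)

section \<open>The upper bound\<close>

lemma connected_matching_forced:
  assumes m: "m \<le> s + t + 1" and n: "n = 2 * (s + t) + 1"
  shows "has_connected_matching (complete_bipartite n n) f Red (s + 1) \<or>
    has_connected_matching (complete_bipartite n n) f Blue (t + 1) \<or>
    has_connected_matching (complete_bipartite n n) f Green m"
proof (rule ccontr)
  let ?G = "complete_bipartite n n"
  assume no: "\<not> ?thesis"
  have cover: "\<exists>(lab :: nat + nat \<Rightarrow> (nat + nat) set) K. finite K \<and> (\<forall>\<mu>. card {v \<in> K. lab v = \<mu>} \<le> u - 1) \<and>
      (\<forall>x y. {x, y} \<in> edges ?G \<longrightarrow> f {x, y} = c \<longrightarrow> covered lab K x y)"
    if "\<not> has_connected_matching ?G f c u" for c u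
    by (rule cover_if_no_connected_matching[OF _ _ _ _ that])
      (auto simp: edges_complete_bipartite verts_complete_bipartite)
  obtain r :: "nat + nat \<Rightarrow> (nat + nat) set" and KR where r: "finite KR"
    "\<And>\<mu>. card {v \<in> KR. r v = \<mu>} \<le> s"
    "\<And>x y. {x, y} \<in> edges ?G \<Longrightarrow> f {x, y} = Red \<Longrightarrow> covered r KR x y"
    using cover[of Red "s + 1"] no by auto
  obtain b :: "nat + nat \<Rightarrow> (nat + nat) set" and KB where b: "finite KB"
    "\<And>\<mu>. card {v \<in> KB. b v = \<mu>} \<le> t"
    "\<And>x y. {x, y} \<in> edges ?G \<Longrightarrow> f {x, y} = Blue \<Longrightarrow> covered b KB x y"
    using cover[of Blue "t + 1"] no by auto
  obtain g :: "nat + nat \<Rightarrow> (nat + nat) set" and KG where g: "finite KG"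
    "\<And>\<mu>. card {v \<in> KG. g v = \<mu>} \<le> m - 1"
    "\<And>x y. {x, y} \<in> edges ?G \<Longrightarrow> f {x, y} = Green \<Longrightarrow> covered g KG x y"
    using cover[of Green m] no by auto
  interpret two_covers r b KR KB s t
    by unfold_locales (use r b in auto)
  show False
  proof (rule no_three_covers)
    show "card {v \<in> KG. g v = \<gamma>} \<le> s + t" for \<gamma> using g(2)[of \<gamma>] m by linarith
    show "card (Inl ` {..<n} :: (nat + nat) set) = 2 * (s + t) + 1"
      "card (Inr ` {..<n} :: (nat + nat) set) = 2 * (s + t) + 1"
      using n by (simp_all add: card_image)
    show "covered r KR x y \<or> covered b KB x y \<or> covered g KG x y"
      if xy: "x \<in> Inl ` {..<n}" "y \<in> Inr ` {..<n}" for x y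
    proof -
      have "{x, y} \<in> edges ?G" using xy by (auto simp: edges_complete_bipartite)
      then show ?thesis using r(3) b(3) g(3) by (cases "f {x, y}") blast+
    qed
  qed (use g in auto)
qed

section \<open>A colouring for the lower bound\<close>

text \<open>The two indices can be read off from an edge, so a colouring may be prescribed by
  indices.\<close>

lemma colouring_of_complete_bipartite: "\<exists>f. \<forall>i j :: nat. f {Inl i, Inr j} = col i j"
proof
  show "\<forall>i j :: nat. (\<lambda>e. col (THE i. Inl i \<in> e) (THE j. Inr j \<in> e)) {Inl i, Inr j} = col i j"
    by simp
qed

lemma connected_matching_avoided:
  assumes n: "n \<le> 2 * (s + t)" and g: "2 * t + s \<le> 2 * g" and "s \<le> t"
  shows "\<exists>f. \<not> has_connected_matching (complete_bipartite n n) f Red (s + 1) \<and>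
    \<not> has_connected_matching (complete_bipartite n n) f Blue (t + 1) \<and>
    \<not> has_connected_matching (complete_bipartite n n) f Green (g + 1)"
proof -
  let ?G = "complete_bipartite n n"
  \<comment> \<open>The left side is cut into consecutive blocks of sizes s, t, s, t, the right side into blocks of
    sizes g, g and at most s. Each block on the left sees the three blocks on the right in three
    different colours.\<close>
  define red :: "nat \<Rightarrow> nat" where
    "red i = (if i < s then 0 else if s + t \<le> i \<and> i < 2 * s + t then 1 else 2)" for i
  define blue :: "nat \<Rightarrow> nat" where
    "blue i = (if i < s then 2 else if i < s + t then 0 else if i < 2 * s + t then 2 else 1)" for i
  define green :: "nat \<Rightarrow> nat" where
    "green i = (if i < s + t then 1 else 0)" for i
  define right :: "nat \<Rightarrow> nat" where
    "right j = (if j < g then 0 else if j < 2 * g then 1 else 2)" for j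
  \<comment> \<open>Red label 0 or 1 is covered by a left block of size \<open>s\<close>, label 2 by
    the third right block. In blue, the left blocks of size at most \<open>t\<close> play this role;
    in green, the two right blocks of size \<open>g\<close> are the covers.\<close>
  define KR :: "(nat + nat) set" where
    "KR = Inl ` ({..<s} \<union> {s + t..<2 * s + t}) \<union> Inr ` {2 * g..<n}"
  define KB :: "(nat + nat) set" where
    "KB = Inl ` ({s..<s + t} \<union> {2 * s + t..<n}) \<union> Inr ` {2 * g..<n}"
  define KG :: "(nat + nat) set" where "KG = Inr ` {..<2 * g}"
  obtain f where f: "\<And>i j. f {Inl i, Inr j} =
      (if red i = right j then Red else if blue i = right j then Blue else Green)"
    using colouring_of_complete_bipartite[of
      "\<lambda>i j. if red i = right j then Red else if blue i = right j then Blue else Green"]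
    by blast
  have avoid: "\<not> has_connected_matching ?G f c u"
    if fin: "finite K" and K: "\<And>\<mu>. card {v \<in> K. case_sum left right v = \<mu>} < u"
      and cov: "\<And>i j. i < n \<Longrightarrow> j < n \<Longrightarrow> f {Inl i, Inr j} = c \<Longrightarrow>
        left i = right j \<and> (Inl i \<in> K \<or> Inr j \<in> K)"
    for c u K and left :: "nat \<Rightarrow> nat"
  proof (rule no_connected_matching_if_cover[where K = K and lab = "case_sum left right"])
    fix x y assume xy: "{x, y} \<in> edges ?G" "f {x, y} = c"
    then obtain i j where ij: "i < n" "j < n" "{x, y} = {Inl i, Inr j}"
      by (auto simp: edges_complete_bipartite)
    then have "left i = right j \<and> (Inl i \<in> K \<or> Inr j \<in> K)" using cov xy by simp
    then show "covered (case_sum left right) K x y"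
      using ij(3) by (auto simp: covered_def doubleton_eq_iff)
  qed (use fin K in \<open>auto simp: edges_complete_bipartite\<close>)
  have card_le: "card A \<le> u" if "A \<subseteq> h ` {p..<q}" "q - p \<le> u"
    for A :: "(nat + nat) set" and h :: "nat \<Rightarrow> nat + nat" and p q u
    using that surj_card_le[of "{p..<q}" A h] by simp
  \<comment> \<open>The lower bound on \<open>g\<close> makes the third right block small enough for
    a red cover, and by \<open>s \<le> t\<close> for a blue one.\<close>
  have W: "n - 2 * g \<le> s" using n g by simp
  have "\<not> has_connected_matching ?G f Red (s + 1)"
  proof (rule avoid[of KR red])
    show "card {v \<in> KR. case_sum red right v = \<mu>} < s + 1" for \<mu>
    proof -
      have "{v \<in> KR. case_sum red right v = \<mu>} \<subseteq>
        (if \<mu> = 0 then Inl ` {0..<s} else if \<mu> = 1 then Inl ` {s + t..<2 * s + t} else Inr ` {2 * g..<n})"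
        by (auto simp: KR_def red_def right_def)
      then show ?thesis using card_le[of _ _ _ _ s] W by (auto split: if_splits simp: less_Suc_eq_le)
    qed
  qed (auto simp: KR_def f red_def right_def split: if_splits)
  moreover have "\<not> has_connected_matching ?G f Blue (t + 1)"
  proof (rule avoid[of KB blue])
    show "card {v \<in> KB. case_sum blue right v = \<mu>} < t + 1" for \<mu>
    proof -
      have "{v \<in> KB. case_sum blue right v = \<mu>} \<subseteq>
        (if \<mu> = 0 then Inl ` {s..<s + t} else if \<mu> = 1 then Inl ` {2 * s + t..<n} else Inr ` {2 * g..<n})"
        by (auto simp: KB_def blue_def right_def)
      then show ?thesis using card_le[of _ _ _ _ t] W n \<open>s \<le> t\<close> by (auto split: if_splits simp: less_Suc_eq_le)
    qed
  qed (auto simp: KB_def f red_def blue_def right_def split: if_splits)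
  moreover have "\<not> has_connected_matching ?G f Green (g + 1)"
  proof (rule avoid[of KG green])
    show "card {v \<in> KG. case_sum green right v = \<mu>} < g + 1" for \<mu>
    proof -
      have "{v \<in> KG. case_sum green right v = \<mu>} \<subseteq> (if \<mu> = 0 then Inr ` {0..<g} else Inr ` {g..<2 * g})"
        by (auto simp: KG_def right_def split: if_splits)
      then show ?thesis using card_le[of _ _ _ _ g] by (auto split: if_splits simp: less_Suc_eq_le)
    qed
  qed (auto simp: KG_def f red_def blue_def green_def right_def split: if_splits)
  ultimately show ?thesis by blast
qed

theorem theorem4p2:
  fixes k l m :: nat
  assumes "3 \<le> k" and "k < l"
    and "real l + (real k - 1) / 2 < real m"
    and "real m < real k + real l - 1"
  shows "int (r k l m) = 2 * int k + 2 * int l - 3"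
proof -
  define s where "s = k - 1"
  define t where "t = l - 1"
  define g where "g = m - 1"
  \<comment> \<open>Doubling turns the hypothesis into one about integers; it yields
    \<open>2 * t + s \<le> 2 * g\<close>.\<close>
  have "real (2 * l + k) < real (2 * m + 1)" using assms(3) by (simp add: field_simps)
  then have "2 * l + k < 2 * m + 1" by (simp only: of_nat_less_iff)
  moreover have "m + 1 < k + l" using assms(4) by linarith
  ultimately have st: "k = s + 1" "l = t + 1" "m = g + 1" "s \<le> t" "2 * t + s \<le> 2 * g" "m \<le> s + t + 1"
    using assms by (simp_all add: s_def t_def g_def)
  let ?N = "2 * (s + t) + 1"
  define forced where "forced n \<longleftrightarrow> (\<forall>f :: (nat + nat) set \<Rightarrow> colour.
     has_connected_matching (complete_bipartite n n) f Red k \<or>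
     has_connected_matching (complete_bipartite n n) f Blue l \<or>
     has_connected_matching (complete_bipartite n n) f Green m)" for n
  have "forced ?N"
    using connected_matching_forced[OF st(6) refl] unfolding forced_def st(1,2) by blast
  \<comment> \<open>Every \<open>n\<close> below \<open>?N\<close> admits an avoiding colouring, so
    \<open>?N\<close> is the least element of the set whose infimum defines
    \<open>r k l m\<close>.\<close>
  moreover have "?N \<le> n" if "forced n" for n
  proof (rule ccontr)
    assume "\<not> ?N \<le> n"
    then have "n \<le> 2 * (s + t)" by simp
    from connected_matching_avoided[OF this st(5,4)] show False
      using that unfolding forced_def st(1,2,3) by blast
  qed
  ultimately have "Inf {n. forced n} = ?N" by (intro cInf_eq_minimum) auto
  then have "r k l m = ?N" unfolding r_def forced_def .
  then show ?thesis using st by simp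
qed

end
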